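(* For all integers $k,\ell\ge 3$, $\chi_o(\vec{DP_k}[\vec{DP_\ell}])=9$.
   Context: An oriented graph is a finite digraph with no loops, no multiple arcs and no pair of opposite arcs. A homomorphism between oriented graphs is a vertex map sending arcs to arcs. The oriented chromatic number $\chi_o(\vec G)$ is the smallest order of an oriented graph $\vec T$ with a homomorphism $\vec G\to\vec T$. $\vec{DP_k}$ denotes the directed path on $k$ vertices $x_1,\dots,x_k$ with arcs $(x_i,x_{i+1})$, $1\le i<k$. The lexicographic product $\vec G[\vec H]$ has vertex set $V(\vec G)\times V(\vec H)$, and $([u,v],[u',v'])$ is an arc iff either $(u,u')$ is an arc of $\vec G$, or $u=u'$ and $(v,v')$ is an arc of $\vec H$. *)

theory Defs
  imports "Graph_Theory.Pair_Digraph"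
begin

locale oriented_graph = pair_digraph +
  assumes no_opposite_arcs: "(u, v) \<in> parcs G \<Longrightarrow> (v, u) \<notin> parcs G"

definition digraph_hom ::
  "('a \<Rightarrow> 'b) \<Rightarrow> 'a pair_pre_digraph \<Rightarrow> 'b pair_pre_digraph \<Rightarrow> bool" where
  "digraph_hom h G H \<longleftrightarrow>
     (\<forall>v \<in> pverts G. h v \<in> pverts H) \<and>
     (\<forall>u v. (u, v) \<in> parcs G \<longrightarrow> (h u, h v) \<in> parcs H)"

text \<open>
  A definition cannot quantify over the vertex type of the target graph. Targets are finite, so
  it suffices to consider those with vertices in \<^typ>\<open>nat\<close>; see
  \<open>oriented_chromatic_number_le\<close> below for targets over an arbitrary type.
\<close>

definition oriented_chromatic_number :: "'a pair_pre_digraph \<Rightarrow> nat" where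
  "oriented_chromatic_number G =
     (LEAST n. \<exists>(T :: nat pair_pre_digraph) h.
        oriented_graph T \<and> card (pverts T) = n \<and> digraph_hom h G T)"

definition directed_path :: "nat \<Rightarrow> nat pair_pre_digraph" where
  "directed_path k = \<lparr> pverts = {1..k}, parcs = {(i, i + 1) | i. 1 \<le> i \<and> i < k} \<rparr>"

definition lex_product ::
  "'a pair_pre_digraph \<Rightarrow> 'b pair_pre_digraph \<Rightarrow> ('a \<times> 'b) pair_pre_digraph" where
  "lex_product G H =
     \<lparr> pverts = pverts G \<times> pverts H,
       parcs = {((u, v), (u', v')) | u v u' v'.
         (u, v) \<in> pverts G \<times> pverts H \<and> (u', v') \<in> pverts G \<times> pverts H \<and>
         ((u, u') \<in> parcs G \<or> u = u' \<and> (v, v') \<in> parcs H)} \<rparr>"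

lemma oriented_graph_directed_path: "oriented_graph (directed_path k)"
proof
  have "parcs (directed_path k) \<subseteq> {1..k} \<times> {1..k}"
    by (auto simp: directed_path_def)
  then show "finite (parcs (directed_path k))"
    by (rule finite_subset) simp
qed (auto simp: directed_path_def)

lemma oriented_graph_lex_product:
  assumes "oriented_graph G" "oriented_graph H"
  shows "oriented_graph (lex_product G H)"
proof -
  interpret G: oriented_graph G by fact
  interpret H: oriented_graph H by fact
  show ?thesis
  proof
    show fin: "finite (pverts (lex_product G H))"
      by (simp add: lex_product_def G.pair_finite_verts H.pair_finite_verts)
    have "parcs (lex_product G H) \<subseteq> pverts (lex_product G H) \<times> pverts (lex_product G H)"
      by (auto simp: lex_product_def)
    then show "finite (parcs (lex_product G H))"
      by (rule finite_subset) (simp add: fin)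
  qed (auto simp: lex_product_def dest: G.no_opposite_arcs H.no_opposite_arcs
         G.pair_no_loops H.pair_no_loops)
qed

lemma oriented_graph_transfer_nat:
  fixes T :: "'b pair_pre_digraph"
  assumes "oriented_graph T" "digraph_hom h G T"
  obtains T' :: "nat pair_pre_digraph" and h'
  where "oriented_graph T'" "card (pverts T') = card (pverts T)" "digraph_hom h' G T'"
proof -
  interpret T: oriented_graph T by fact
  obtain f :: "'b \<Rightarrow> nat" where f: "inj_on f (pverts T)"
    using T.pair_finite_verts finite_imp_inj_to_nat_seg by blast
  define T' where "T' = \<lparr> pverts = f ` pverts T, parcs = map_prod f f ` parcs T \<rparr>"
  have no_loop: "(v, v) \<notin> parcs T" for v
    using T.no_opposite_arcs by blast
  have "oriented_graph T'"
  proof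
    show "finite (pverts T')" "finite (parcs T')"
      by (simp_all add: T'_def T.pair_finite_verts T.pair_finite_arcs)
  qed (auto simp: T'_def inj_on_eq_iff[OF f] T.wellformed' no_loop
         dest: T.no_opposite_arcs)
  moreover have "card (pverts T') = card (pverts T)"
    by (simp add: T'_def card_image f)
  moreover have "digraph_hom (f \<circ> h) G T'"
    using assms(2) by (auto simp: digraph_hom_def T'_def)
  ultimately show ?thesis by (rule that)
qed

lemma oriented_chromatic_number_le:
  assumes "oriented_graph T" "digraph_hom h G T"
  shows "oriented_chromatic_number G \<le> card (pverts T)"
proof -
  obtain T' :: "nat pair_pre_digraph" and h'
    where "oriented_graph T'" "card (pverts T') = card (pverts T)" "digraph_hom h' G T'"
    using oriented_graph_transfer_nat[OF assms] .
  then show ?thesis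
    unfolding oriented_chromatic_number_def by (intro Least_le) blast
qed

lemma oriented_chromatic_number_attained:
  assumes "oriented_graph G"
  obtains T :: "nat pair_pre_digraph" and h
  where "oriented_graph T" "card (pverts T) = oriented_chromatic_number G" "digraph_hom h G T"
proof -
  have "digraph_hom id G G" by (simp add: digraph_hom_def)
  from oriented_graph_transfer_nat[OF assms this]
  have "\<exists>n (T :: nat pair_pre_digraph) h.
      oriented_graph T \<and> card (pverts T) = n \<and> digraph_hom h G T" by blast
  from LeastI_ex[OF this] show ?thesis
    using that unfolding oriented_chromatic_number_def by blast
qed

end

theory Submission
  imports Defs
begin

text \<open>
  Both paths map to the directed triangle, and lexicographic products are functorial in both
  factors, so the product maps to the product of two triangles, which has nine vertices.
  Conversely, any two distinct vertices among the first three copies of the first three path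
  vertices are joined by a directed walk of length one or two, so no homomorphism to an
  oriented graph can identify them.
\<close>

text \<open>Equal images would turn the arc into a loop, which is its own opposite arc and so is
  excluded by \<open>no_opposite_arcs\<close>.\<close>

lemma digraph_hom_arc_neq:
  assumes "oriented_graph T" "digraph_hom h G T" "(u, v) \<in> parcs G"
  shows "h u \<noteq> h v"
  using assms oriented_graph.no_opposite_arcs unfolding digraph_hom_def by metis

text \<open>Equal images of the two ends would make the images of the two arcs opposite to each
  other.\<close>

lemma digraph_hom_two_path_neq:
  assumes "oriented_graph T" "digraph_hom h G T" "(u, w) \<in> parcs G" "(w, v) \<in> parcs G"
  shows "h u \<noteq> h v"
  using assms oriented_graph.no_opposite_arcs unfolding digraph_hom_def by metis

lemma digraph_hom_lex_product:
  assumes "digraph_hom f G G'" "digraph_hom g H H'"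
  shows "digraph_hom (map_prod f g) (lex_product G H) (lex_product G' H')"
  using assms by (auto simp: digraph_hom_def lex_product_def)

definition directed_triangle :: "nat pair_pre_digraph" where
  "directed_triangle = \<lparr> pverts = {0, 1, 2}, parcs = {(0, 1), (1, 2), (2, 0)} \<rparr>"

lemma oriented_graph_directed_triangle: "oriented_graph directed_triangle"
  by standard (auto simp: directed_triangle_def)

text \<open>The path winds around the triangle: each arc advances the residue one step along the
  cycle 0, 1, 2, 0.\<close>

lemma digraph_hom_directed_path_triangle:
  "digraph_hom (\<lambda>i. i mod 3) (directed_path k) directed_triangle"
proof -
  have "i mod 3 = 0 \<and> Suc i mod 3 = 1 \<or> i mod 3 = 1 \<and> Suc i mod 3 = 2 \<or>
      i mod 3 = 2 \<and> Suc i mod 3 = 0" for i :: nat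
    by presburger
  then show ?thesis
    by (fastforce simp: digraph_hom_def directed_path_def directed_triangle_def)
qed

lemma oriented_chromatic_number_lex_directed_paths_le:
  "oriented_chromatic_number (lex_product (directed_path k) (directed_path l)) \<le> 9"
proof -
  let ?T = "lex_product directed_triangle directed_triangle"
  have "oriented_chromatic_number (lex_product (directed_path k) (directed_path l))
      \<le> card (pverts ?T)"
    by (rule oriented_chromatic_number_le
        [OF oriented_graph_lex_product digraph_hom_lex_product])
      (rule oriented_graph_directed_triangle digraph_hom_directed_path_triangle)+
  also have "card (pverts ?T) = 9"
    by (simp add: lex_product_def directed_triangle_def card_cartesian_product)
  finally show ?thesis .
qed

lemma inj_on_digraph_hom_lex_directed_paths:
  assumes "k \<ge> 3" "l \<ge> 3" and T: "oriented_graph T"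
    and h: "digraph_hom h (lex_product (directed_path k) (directed_path l)) T"
  shows "inj_on h ({1..3} \<times> {1..3})"
proof -
  let ?G = "lex_product (directed_path k) (directed_path l)"
  have arc: "((a, b), (a', b')) \<in> parcs ?G"
    if "a \<in> {1..3}" "b \<in> {1..3}" "a' \<in> {1..3}" "b' \<in> {1..3}"
      "a' = a + 1 \<or> a = a' \<and> b' = b + 1" for a b a' b' :: nat
    using that assms(1,2) by (auto simp: lex_product_def directed_path_def)
  \<comment> \<open>Ordering the pairs lexicographically fixes the direction of the joining walk;
    injectivity then follows by symmetry.\<close>
  have neq: "h (a, b) \<noteq> h (a', b')"
    if in3: "a \<in> {1..3}" "b \<in> {1..3}" "a' \<in> {1..3}" "b' \<in> {1..3}"
      and less: "a < a' \<or> a = a' \<and> b < b'" for a b a' b' :: nat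
  proof -
    consider "a' = a + 1 \<or> a = a' \<and> b' = b + 1" | "a = 1" "a' = 3" | "a = a'" "b = 1" "b' = 3"
      using in3 less by (auto simp: le_Suc_eq numeral_3_eq_3)
    then show ?thesis
    proof cases
      case 1
      then show ?thesis
        using digraph_hom_arc_neq[OF T h] arc in3 by blast
    next
      case 2
      \<comment> \<open>Consecutive copies are completely joined, so copy 2 links the outer copies
        for any second coordinates; \<open>b\<close> is just one choice of midpoint.\<close>
      then show ?thesis
        using in3 by (intro digraph_hom_two_path_neq[OF T h, of _ "(2, b)"] arc) auto
    next
      case 3
      \<comment> \<open>Here the walk stays inside copy \<open>a\<close> and passes through the
        middle vertex of its path.\<close>
      then show ?thesis
        using in3 by (intro digraph_hom_two_path_neq[OF T h, of _ "(a, 2)"] arc) auto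
    qed
  qed
  show ?thesis
  proof (rule inj_onI, rule ccontr)
    fix x y :: "nat \<times> nat"
    assume x: "x \<in> {1..3} \<times> {1..3}" and y: "y \<in> {1..3} \<times> {1..3}"
      and eq: "h x = h y" and "x \<noteq> y"
    obtain a b a' b' where "x = (a, b)" "y = (a', b')"
      by (cases x, cases y)
    with x y eq \<open>x \<noteq> y\<close> neq[of a b a' b'] neq[of a' b' a b] show False
      by (cases a a' rule: linorder_cases; cases b b' rule: linorder_cases) auto
  qed
qed

theorem theorem5:
  fixes k l :: nat
  assumes "k \<ge> 3" and "l \<ge> 3"
  shows "oriented_chromatic_number (lex_product (directed_path k) (directed_path l)) = 9"
proof (rule antisym[OF oriented_chromatic_number_lex_directed_paths_le])
  let ?G = "lex_product (directed_path k) (directed_path l)"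
  have "oriented_graph ?G"
    by (intro oriented_graph_lex_product oriented_graph_directed_path)
  then obtain T :: "nat pair_pre_digraph" and h
    where T: "oriented_graph T" and card_T: "card (pverts T) = oriented_chromatic_number ?G"
      and h: "digraph_hom h ?G T"
    by (rule oriented_chromatic_number_attained)
  interpret T: oriented_graph T by (rule T)
  have "h ` ({1..3} \<times> {1..3}) \<subseteq> pverts T"
    using h assms by (auto simp: digraph_hom_def lex_product_def directed_path_def)
  \<comment> \<open>The nine vertices of the 3 by 3 corner have distinct images in a target of
    optimal order.\<close>
  then have "card ({1..3::nat} \<times> {1..3::nat}) \<le> card (pverts T)"
    by (rule card_inj_on_le[OF inj_on_digraph_hom_lex_directed_paths[OF assms T h]])
      (rule T.pair_finite_verts)
  then show "9 \<le> oriented_chromatic_number ?G"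
    by (simp add: card_T card_cartesian_product)
qed

end
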